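(* Let $\{(w_k;y_k;\lambda_k)\}_{k\ge0}$ be generated by the scheme ADMM$_{\rm cf}^{\mu,\alpha,\rho}$ and suppose that the sequences $\{w_k\}$ and $\{y_k\}$ are bounded. In addition, assume that there exist $\rho_->0$ and a real constant $l$ such that $h(w)+p(y)+\frac{\rho_-}{2}\|w-y\|^2\ge l$ for all $w\in Z_1$, $y\in Z_2$. Then for any $\epsilon>0$ such that $\epsilon\le 1/(4\rho_-+2)$, if the parameters and starting point of the scheme satisfy $$\alpha=\epsilon,\qquad \rho=\frac1{2\epsilon},\qquad \mu>\frac2\epsilon,\qquad w_0=y_0,$$ then a subsequence of $\{(w_k;y_k;\lambda_k)\}_{k\ge1}$ converges to a point $(w^*;y^*;\lambda^* )$ such that $$0\in\partial(h+\mathbf{1}_{Z_1})(w^* )+\lambda^*,\qquad 0\in\partial(p+\mathbf{1}_{Z_2})(y^* )-\lambda^*,$$ $$\|w^*-y^*\|^2\le\alpha^2\|\lambda^*\|^2\le\big(64(h(w_0)+p(y_0))-64l+(14+5\epsilon)\|\lambda_0\|^2\big)\,\epsilon.$$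
   Context: Let $A\in\mathbb{R}^{m\times n}$, $b\in\mathbb{R}^m$, $\gamma>0$, $f_Q(x)=x^TMx+d^Tx$ with $M\in\mathbb{R}^{n\times n}$ symmetric, $d\in\mathbb{R}^n$, and $g:\mathbb{R}^n\to\mathbb{R}$ smooth convex. Write $w=(x^+;x^-;\xi)$, $y=(y^+;y^-;\zeta)\in\mathbb{R}^{3n}$, and $$h(w)=f_Q(x^+-x^-)+\gamma\sum_{i=1}^n(1-\xi_i),\quad p(y)=g(y^+-y^-),$$ $$Z_1=\{(x^+;x^-;\xi):(x^++x^-)^T\xi=0\},$$ $$Z_2=\{(x^+;x^-;\xi):x^+\ge0,\ x^-\ge0,\ 0\le\xi_i\le1\ \forall i,\ A(x^+-x^-)\ge b\},$$ $$\tilde{\mathcal{L}}_{\rho,\alpha}(w,y,\lambda)=h(w)+p(y)+(1-\rho\alpha)\lambda^T(w-y-\alpha\lambda)+\frac\rho2\|w-y\|^2.$$ Scheme ADMM$_{\rm cf}^{\mu,\alpha,\rho}$: parameters $\alpha,\rho,\mu>0$ with $\rho\alpha\in(0,1)$ and $(\rho+\mu)I+4M\succ0$; given $w_0,y_0,\lambda_0\in\mathbb{R}^{3n}$; for $k\ge0$ (the stopping test is disregarded, so the sequence is infinite) $$w_{k+1}\in\mathrm{argmin}_{w\in Z_1}\ \tilde{\mathcal{L}}_{\rho,\alpha}(w,y_k,\lambda_k)+\frac\mu2\|w-w_k\|^2,\quad y_{k+1}=\mathrm{argmin}_{y\in Z_2}\ \tilde{\mathcal{L}}_{\rho,\alpha}(w_{k+1},y,\lambda_k),$$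 $$\lambda_{k+1}=(1-\rho\alpha)\lambda_k+\rho(w_{k+1}-y_{k+1}).$$ $\mathbf{1}_Z(z)=0$ if $z\in Z$ and $+\infty$ otherwise. For a proper lower semicontinuous $F$ and $x\in\mathrm{dom}\,F$, $\partial F(x)$ is the limiting subdifferential: the set of $v$ for which there exist $x_k\to x$ with $F(x_k)\to F(x)$ and $v_k\to v$ with $v_k$ in the Fréchet subdifferential of $F$ at $x_k$, i.e. $\liminf_{z\to x_k,z\ne x_k}\frac{F(z)-F(x_k)-v_k^T(z-x_k)}{\|z-x_k\|}\ge0$.
   Formalization: The formal theorem additionally assumes that the common starting point w_0 = y_0 is feasible, i.e. lies in both Z_1 and Z_2; without this the right-hand side of the bound can be negative and the claimed bound fails. *)

theory Defs
  imports "HOL-Analysis.Analysis"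
begin

text \<open>
  Points of \<open>\<real>\<^sup>3\<^sup>n\<close>, written as stacked triples \<open>(x\<^sup>+; x\<^sup>-; \<xi>)\<close>, live in the product type
  below; its norm and inner product are the Euclidean ones of the stacked vector.
\<close>

type_synonym 'n triple = "(real ^ 'n) \<times> (real ^ 'n) \<times> (real ^ 'n)"

definition positive_definite :: "real ^ 'n ^ 'n \<Rightarrow> bool" where
  "positive_definite P \<longleftrightarrow> (\<forall>x. x \<noteq> 0 \<longrightarrow> x \<bullet> (P *v x) > 0)"

definition continuously_differentiable :: "('a::euclidean_space \<Rightarrow> real) \<Rightarrow> bool" where
  "continuously_differentiable g \<longleftrightarrow>
     (\<exists>G. continuous_on UNIV G \<and> (\<forall>x. (g has_derivative (\<lambda>v. G x \<bullet> v)) (at x)))"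

definition f_Q :: "real ^ 'n ^ 'n \<Rightarrow> real ^ 'n \<Rightarrow> real ^ 'n \<Rightarrow> real" where
  "f_Q M d x = x \<bullet> (M *v x) + d \<bullet> x"

definition h_fun :: "real ^ 'n ^ 'n \<Rightarrow> real ^ 'n \<Rightarrow> real \<Rightarrow> 'n triple \<Rightarrow> real" where
  "h_fun M d \<gamma> = (\<lambda>(xp, xm, \<xi>). f_Q M d (xp - xm) + \<gamma> * (\<Sum>i\<in>UNIV. 1 - \<xi> $ i))"

definition p_fun :: "(real ^ 'n \<Rightarrow> real) \<Rightarrow> 'n triple \<Rightarrow> real" where
  "p_fun g = (\<lambda>(yp, ym, \<zeta>). g (yp - ym))"

definition Z1 :: "('n::finite) triple set" where
  "Z1 = {(xp, xm, \<xi>). (xp + xm) \<bullet> \<xi> = 0}"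

definition Z2 :: "real ^ ('n::finite) ^ ('m::finite) \<Rightarrow> real ^ 'm \<Rightarrow> 'n triple set" where
  "Z2 A b = {(xp, xm, \<xi>).
     (\<forall>i. xp $ i \<ge> 0) \<and> (\<forall>i. xm $ i \<ge> 0) \<and> (\<forall>i. 0 \<le> \<xi> $ i \<and> \<xi> $ i \<le> 1) \<and>
     (\<forall>j. (A *v (xp - xm)) $ j \<ge> b $ j)}"

definition aug_lagrangian ::
  "(('n::finite) triple \<Rightarrow> real) \<Rightarrow> ('n triple \<Rightarrow> real) \<Rightarrow> real \<Rightarrow> real \<Rightarrow>
   'n triple \<Rightarrow> 'n triple \<Rightarrow> 'n triple \<Rightarrow> real" where
  "aug_lagrangian h p \<rho> \<alpha> w y lam =
     h w + p y + (1 - \<rho> * \<alpha>) * (lam \<bullet> (w - y - \<alpha> *\<^sub>R lam)) + \<rho> / 2 * (norm (w - y))\<^sup>2"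

text \<open>The sequences \<open>w, y, lam\<close> are generated by the scheme with parameters \<open>\<mu>, \<alpha>, \<rho>\<close>.\<close>

definition ADMM_cf ::
  "real ^ 'n ^ 'n \<Rightarrow> real ^ 'n \<Rightarrow> real \<Rightarrow> (real ^ 'n \<Rightarrow> real) \<Rightarrow> real ^ 'n ^ 'm \<Rightarrow> real ^ 'm \<Rightarrow>
   real \<Rightarrow> real \<Rightarrow> real \<Rightarrow>
   (nat \<Rightarrow> 'n triple) \<Rightarrow> (nat \<Rightarrow> 'n triple) \<Rightarrow> (nat \<Rightarrow> 'n triple) \<Rightarrow> bool" where
  "ADMM_cf M d \<gamma> g A b \<mu> \<alpha> \<rho> w y lam \<longleftrightarrow>
     \<alpha> > 0 \<and> \<rho> > 0 \<and> \<mu> > 0 \<and> 0 < \<rho> * \<alpha> \<and> \<rho> * \<alpha> < 1 \<and>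
     positive_definite ((\<rho> + \<mu>) *\<^sub>R mat 1 + 4 *\<^sub>R M) \<and>
     (\<forall>k.
        is_arg_min (\<lambda>u. aug_lagrangian (h_fun M d \<gamma>) (p_fun g) \<rho> \<alpha> u (y k) (lam k)
                        + \<mu> / 2 * (norm (u - w k))\<^sup>2)
          (\<lambda>u. u \<in> Z1) (w (Suc k)) \<and>
        is_arg_min (\<lambda>v. aug_lagrangian (h_fun M d \<gamma>) (p_fun g) \<rho> \<alpha> (w (Suc k)) v (lam k))
          (\<lambda>v. v \<in> Z2 A b) (y (Suc k)) \<and>
        lam (Suc k) = (1 - \<rho> * \<alpha>) *\<^sub>R lam k + \<rho> *\<^sub>R (w (Suc k) - y (Suc k)))"

definition indicator_fun :: "'a set \<Rightarrow> 'a \<Rightarrow> ereal" where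
  "indicator_fun Z z = (if z \<in> Z then 0 else \<infinity>)"

text \<open>
  Both subdifferentials are empty outside the effective domain. The filter \<open>at x\<close> is punctured
  at \<open>x\<close>, so the quotient is only considered for \<open>z \<noteq> x\<close>.
\<close>

definition frechet_subdifferential :: "('a::euclidean_space \<Rightarrow> ereal) \<Rightarrow> 'a \<Rightarrow> 'a set" where
  "frechet_subdifferential F x =
     {v. \<bar>F x\<bar> \<noteq> \<infinity> \<and>
         Liminf (at x) (\<lambda>z. (F z - F x - ereal (v \<bullet> (z - x))) / ereal (norm (z - x))) \<ge> 0}"

definition limiting_subdifferential :: "('a::euclidean_space \<Rightarrow> ereal) \<Rightarrow> 'a \<Rightarrow> 'a set" where
  "limiting_subdifferential F x =
     {v. \<bar>F x\<bar> \<noteq> \<infinity> \<and>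
         (\<exists>X V. X \<longlonglongrightarrow> x \<and> (\<lambda>k. F (X k)) \<longlonglongrightarrow> F x \<and> V \<longlonglongrightarrow> v \<and>
                (\<forall>k. V k \<in> frechet_subdifferential F (X k)))}"

end

theory Submission
  imports Defs
begin

text \<open>
  The parameters satisfy \<open>\<rho> * \<alpha> = 1 / 2\<close>, so the multiplier update reads
  \<open>w\<^sub>k\<^sub>+\<^sub>1 - y\<^sub>k\<^sub>+\<^sub>1 = \<alpha> (2 \<lambda>\<^sub>k\<^sub>+\<^sub>1 - \<lambda>\<^sub>k)\<close>: once the multipliers settle, the residual is
  \<open>\<alpha> \<lambda>\<^sup>*\<close>. Everything rests on showing that consecutive iterates merge.

  The minimisation over the convex set \<open>Z\<^sub>2\<close> makes \<open>\<lambda>\<^sub>k\<^sub>+\<^sub>1\<close> a subgradient of \<open>p + 1\<^sub>Z\<^sub>2\<close> at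
  \<open>y\<^sub>k\<^sub>+\<^sub>1\<close> (\<open>multiplier_subgradient\<close>). Hence \<open>\<lambda>\<close> and \<open>y\<close> move monotonically together, the term
  in \<open>y\<close> can be dropped from the recursion for \<open>\<lambda>\<^sub>k\<^sub>+\<^sub>1 - \<lambda>\<^sub>k\<close>, and the multiplier increments
  are controlled by a contraction driven by the increments of \<open>w\<close>
  (\<open>multiplier_increment\<close>). The two minimisations decrease the augmented Lagrangian by
  quadratic amounts, and the multiplier update increases it by a telescoping term plus
  \<open>3 / 4 \<alpha> |\<lambda>\<^sub>k\<^sub>+\<^sub>1 - \<lambda>\<^sub>k|\<^sup>2\<close>. Since \<open>\<mu> > 2 / \<alpha>\<close>, the decrease in \<open>w\<close> dominates that term, so a
  suitable merit function decreases by a multiple of all three squared increments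
  (\<open>merit_decrease\<close>).

  Bounded \<open>w\<close> and \<open>y\<close> force bounded multipliers, because the update halves the old multiplier.
  A convergent subsequence therefore exists, along which the merit function stays bounded; being
  monotone it converges, and all increments vanish (\<open>convergent_subsequence\<close>). In the limit
  \<open>w\<^sup>*\<close> minimises over \<open>Z\<^sub>1\<close> the function \<open>h\<close> plus a linear and a quadratic term, although \<open>Z\<^sub>1\<close> is
  not convex. So \<open>h\<close> has on \<open>Z\<^sub>1\<close> a concave quadratic minorant touching at \<open>w\<^sup>*\<close> with slope
  \<open>- \<lambda>\<^sup>*\<close>, which makes \<open>- \<lambda>\<^sup>*\<close> even a Frechet subgradient
  (\<open>quadratic_minorant_imp_limiting_subgradient\<close>).

  For the bound, the limit of the merit function is \<open>h(w\<^sup>*) + p(y\<^sup>*) + \<alpha> / 2 |\<lambda>\<^sup>*|\<^sup>2\<close>, and the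
  penalised lower bound \<open>l\<close> costs at most \<open>\<alpha> / 8 |\<lambda>\<^sup>*|\<^sup>2\<close> of it because \<open>\<rho> \<ge> 2 \<rho>\<^sub>-\<close>. The initial
  value of the merit function is estimated separately, since \<open>y\<^sub>0\<close> is no minimiser and
  monotonicity is not available for the first step; there the same lower bound limits how far
  the first iterates can move (\<open>merit_start_le\<close>).
\<close>

section \<open>Subgradients from quadratic minorants\<close>

text \<open>
  The Frechet quotient is bounded below by \<open>- C * norm (z - x)\<close>, which vanishes at \<open>x\<close>; off \<open>Z\<close>
  the quotient is infinite.
\<close>
lemma quadratic_minorant_imp_limiting_subgradient:
  fixes f :: "'a::euclidean_space \<Rightarrow> real"
  assumes x: "x \<in> Z"
    and minorant: "\<And>u. u \<in> Z \<Longrightarrow> f x + v \<bullet> (u - x) - C * (norm (u - x))\<^sup>2 \<le> f u"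
  shows "v \<in> limiting_subdifferential (\<lambda>u. ereal (f u) + indicator_fun Z u) x"
proof -
  let ?F = "\<lambda>u. ereal (f u) + indicator_fun Z u"
  let ?Q = "\<lambda>z. (?F z - ?F x - ereal (v \<bullet> (z - x))) / ereal (norm (z - x))"
  have Fx: "?F x = ereal (f x)"
    using x by (simp add: indicator_fun_def)
  have quotient: "ereal (- C * norm (z - x)) \<le> ?Q z" if "z \<noteq> x" for z
  proof (cases "z \<in> Z")
    case True
    have pos: "norm (z - x) > 0" using that by simp
    have "- C * norm (z - x) * norm (z - x) \<le> f z - f x - v \<bullet> (z - x)"
      using minorant[OF True] by (simp add: power2_eq_square algebra_simps)
    then have "- C * norm (z - x) \<le> (f z - f x - v \<bullet> (z - x)) / norm (z - x)"
      using pos by (simp add: pos_le_divide_eq)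
    then show ?thesis
      using True pos x by (simp add: indicator_fun_def)
  next
    case False
    have pos: "norm (z - x) > 0" using that by simp
    then have "?Q z = \<infinity>"
      using False x by (simp add: indicator_fun_def)
    then show ?thesis by simp
  qed
  have "((\<lambda>z. - C * norm (z - x)) \<longlongrightarrow> - C * norm (x - x)) (at x)"
    by (intro tendsto_intros)
  then have "((\<lambda>z. ereal (- C * norm (z - x))) \<longlongrightarrow> 0) (at x)"
    by (simp add: zero_ereal_def)
  then have "Liminf (at x) (\<lambda>z. ereal (- C * norm (z - x))) = 0"
    by (intro lim_imp_Liminf) simp_all
  moreover have "Liminf (at x) (\<lambda>z. ereal (- C * norm (z - x))) \<le> Liminf (at x) ?Q"
    by (rule Liminf_mono) (use quotient in \<open>unfold eventually_at_filter, blast intro: always_eventually\<close>)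
  ultimately have "v \<in> frechet_subdifferential ?F x"
    unfolding frechet_subdifferential_def using Fx by simp
  then show ?thesis
    unfolding limiting_subdifferential_def using Fx
    by (intro CollectI conjI, simp) (rule exI[of _ "\<lambda>_. x"], rule exI[of _ "\<lambda>_. v"], simp)
qed

section \<open>The merit function of the scheme\<close>

lemma power2_norm_diff_expand:
  fixes a u v :: "'a::real_inner"
  shows "(norm (a - v))\<^sup>2 = (norm (a - u))\<^sup>2 - 2 * ((a - u) \<bullet> (v - u)) + (norm (v - u))\<^sup>2"
  by (simp add: power2_norm_eq_inner inner_diff_left inner_diff_right inner_commute)

text \<open>
  The convergence argument sees only continuous \<open>h\<close> and \<open>p\<close>, a closed set for \<open>w\<close> and a closed
  convex one for \<open>y\<close>, on which \<open>p\<close> is convex. The three iteration laws are those of the scheme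
  for \<open>\<rho> * \<alpha> = 1 / 2\<close>, with the terms of the Lagrangian that are constant in the minimised
  variable removed.
\<close>
locale balanced_proximal_admm =
  fixes h p :: "'a::euclidean_space \<Rightarrow> real" and Z Y :: "'a set"
    and \<alpha> \<rho> \<mu> :: real and w y lam :: "nat \<Rightarrow> 'a"
  assumes \<alpha>_pos: "\<alpha> > 0" and \<rho>_eq: "\<rho> = 1 / (2 * \<alpha>)" and \<mu>_large: "\<mu> > 2 / \<alpha>"
    and cont_h: "continuous_on UNIV h" and cont_p: "continuous_on UNIV p"
    and closed_Z: "closed Z" and closed_Y: "closed Y" and convex_p: "convex_on Y p"
    and w_in: "\<And>k. w k \<in> Z" and y_in: "\<And>k. y k \<in> Y"
    and w_min: "\<And>k u. u \<in> Z \<Longrightarrow>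
      h (w (Suc k)) + (1 / 2) * (lam k \<bullet> w (Suc k)) + \<rho> / 2 * (norm (w (Suc k) - y k))\<^sup>2
        + \<mu> / 2 * (norm (w (Suc k) - w k))\<^sup>2
      \<le> h u + (1 / 2) * (lam k \<bullet> u) + \<rho> / 2 * (norm (u - y k))\<^sup>2 + \<mu> / 2 * (norm (u - w k))\<^sup>2"
    and y_min: "\<And>k v. v \<in> Y \<Longrightarrow>
      p (y (Suc k)) - (1 / 2) * (lam k \<bullet> y (Suc k)) + \<rho> / 2 * (norm (w (Suc k) - y (Suc k)))\<^sup>2
      \<le> p v - (1 / 2) * (lam k \<bullet> v) + \<rho> / 2 * (norm (w (Suc k) - v))\<^sup>2"
    and lam_step: "\<And>k. lam (Suc k) = (1 / 2) *\<^sub>R lam k + \<rho> *\<^sub>R (w (Suc k) - y (Suc k))"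
begin

lemma \<rho>_pos: "\<rho> > 0" and \<rho>\<alpha>: "\<rho> * \<alpha> = 1 / 2"
  using \<alpha>_pos by (simp_all add: \<rho>_eq)

lemma residual: "w (Suc k) - y (Suc k) = \<alpha> *\<^sub>R (2 *\<^sub>R lam (Suc k) - lam k)"
proof -
  have "2 *\<^sub>R lam (Suc k) - lam k = (2 * \<rho>) *\<^sub>R (w (Suc k) - y (Suc k))"
    unfolding lam_step by (simp add: scaleR_right_distrib)
  then show ?thesis using \<alpha>_pos by (simp add: \<rho>_eq)
qed

text \<open>
  Compare the minimiser with the point a fraction \<open>t\<close> along the segment towards \<open>v\<close>: convexity of
  \<open>p\<close> makes the change at most \<open>t * (a + t * q)\<close>, where \<open>a\<close> is the gap in the subgradient
  inequality, and \<open>t\<close> tends to 0.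
\<close>
lemma multiplier_subgradient:
  assumes v: "v \<in> Y"
  shows "p (y (Suc k)) + lam (Suc k) \<bullet> (v - y (Suc k)) \<le> p v"
proof -
  define z where "z = y (Suc k)"
  define a where "a = p v - p z - lam (Suc k) \<bullet> (v - z)"
  define q where "q = \<rho> / 2 * (norm (v - z))\<^sup>2"
  have z: "z \<in> Y" using y_in z_def by simp
  have slope: "0 \<le> a + t * q" if t: "0 < t" "t < 1" for t
  proof -
    let ?x = "(1 - t) *\<^sub>R z + t *\<^sub>R v"
    have x: "?x \<in> Y" "p ?x \<le> (1 - t) * p z + t * p v"
      using t z v convex_p convexD_alt[OF convex_on_imp_convex[OF convex_p] z v, of t]
        convex_onD[OF convex_p _ _ z v, of t] by simp_all
    have d: "?x - z = t *\<^sub>R (v - z)" by (simp add: algebra_simps)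
    have n: "(norm (w (Suc k) - ?x))\<^sup>2 = (norm (w (Suc k) - z))\<^sup>2
        - 2 * t * ((w (Suc k) - z) \<bullet> (v - z)) + t\<^sup>2 * (norm (v - z))\<^sup>2"
      by (subst power2_norm_diff_expand[of _ _ z]) (simp only: d, simp add: power_mult_distrib)
    have l: "lam k \<bullet> ?x = lam k \<bullet> z + t * (lam k \<bullet> (v - z))"
      by (simp add: inner_simps algebra_simps)
    have m: "lam (Suc k) \<bullet> (v - z)
        = (1 / 2) * (lam k \<bullet> (v - z)) + \<rho> * ((w (Suc k) - z) \<bullet> (v - z))"
      unfolding lam_step z_def by (simp add: inner_add_left)
    have "0 \<le> p ?x - p z - (1 / 2) * t * (lam k \<bullet> (v - z))
        - \<rho> * t * ((w (Suc k) - z) \<bullet> (v - z)) + \<rho> / 2 * t\<^sup>2 * (norm (v - z))\<^sup>2"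
      using y_min[OF x(1), of k] unfolding l n z_def[symmetric] by (simp add: algebra_simps)
    also have "\<dots> \<le> t * (a + t * q)"
      using x(2) unfolding a_def q_def m by (simp add: algebra_simps power2_eq_square)
    finally show ?thesis using t by (simp add: zero_le_mult_iff)
  qed
  have "((\<lambda>t. a + t * q) \<longlongrightarrow> a + 0 * q) (at_right 0)"
    by (intro tendsto_intros)
  moreover have "\<forall>\<^sub>F t in at_right 0. 0 \<le> a + t * q"
    using eventually_at_right_less[of "0::real"] slope
    by (auto simp: eventually_at_right_field intro!: exI[of _ 1])
  ultimately have "0 \<le> a + 0 * q"
    by (rule tendsto_lowerbound) simp
  then show ?thesis by (simp add: a_def z_def)
qed

definition lagrangian :: "'a \<Rightarrow> 'a \<Rightarrow> 'a \<Rightarrow> real" where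
  "lagrangian u v q = h u + p v + (1 / 2) * (q \<bullet> (u - v - \<alpha> *\<^sub>R q)) + \<rho> / 2 * (norm (u - v))\<^sup>2"

lemma w_descent:
  "lagrangian (w (Suc k)) (y k) (lam k) + \<mu> / 2 * (norm (w (Suc k) - w k))\<^sup>2
    \<le> lagrangian (w k) (y k) (lam k)"
  using w_min[OF w_in[of k], of k] unfolding lagrangian_def
  by (simp add: inner_diff_right algebra_simps)

text \<open>
  The penalty is a quadratic with Hessian \<open>\<rho>\<close> in \<open>y\<close>, so the minimum is attained with quadratic
  growth; the subgradient inequality supplies exactly the linear part of the expansion.
\<close>
lemma y_descent:
  "lagrangian (w (Suc k)) (y (Suc k)) (lam k) + \<rho> / 2 * (norm (y (Suc k) - y k))\<^sup>2
    \<le> lagrangian (w (Suc k)) (y k) (lam k)"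
proof -
  define E where "E = (w (Suc k) - y (Suc k)) \<bullet> (y k - y (Suc k))"
  have m: "lam (Suc k) \<bullet> (y k - y (Suc k)) = (1 / 2) * (lam k \<bullet> (y k - y (Suc k))) + \<rho> * E"
    unfolding lam_step E_def by (simp add: inner_add_left)
  have n: "(norm (w (Suc k) - y k))\<^sup>2
      = (norm (w (Suc k) - y (Suc k)))\<^sup>2 - 2 * E + (norm (y (Suc k) - y k))\<^sup>2"
    unfolding power2_norm_diff_expand[of "w (Suc k)" "y k" "y (Suc k)"] E_def
    by (simp add: norm_minus_commute[of "y k"])
  have "p (y (Suc k)) + lam (Suc k) \<bullet> (y k - y (Suc k)) \<le> p (y k)"
    by (rule multiplier_subgradient[OF y_in])
  then show ?thesis
    unfolding lagrangian_def m n by (simp add: inner_diff_right algebra_simps)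
qed

text \<open>
  Substituting the residual turns the change of the Lagrangian into a quadratic form in the two
  multipliers; adding \<open>\<alpha> / 4 * (norm \<lambda>)\<^sup>2\<close> to the Lagrangian completes it to a square.
\<close>
lemma multiplier_ascent:
  "lagrangian (w (Suc k)) (y (Suc k)) (lam (Suc k)) + \<alpha> / 4 * (norm (lam (Suc k)))\<^sup>2
    = lagrangian (w (Suc k)) (y (Suc k)) (lam k) + \<alpha> / 4 * (norm (lam k))\<^sup>2
      + 3 / 4 * \<alpha> * (norm (lam (Suc k) - lam k))\<^sup>2"
  unfolding lagrangian_def residual
  by (simp add: power2_norm_eq_inner inner_simps inner_commute algebra_simps)

lemma step_estimate:
  "lagrangian (w (Suc k)) (y (Suc k)) (lam (Suc k)) + \<alpha> / 4 * (norm (lam (Suc k)))\<^sup>2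
      + \<mu> / 2 * (norm (w (Suc k) - w k))\<^sup>2 + \<rho> / 2 * (norm (y (Suc k) - y k))\<^sup>2
    \<le> lagrangian (w k) (y k) (lam k) + \<alpha> / 4 * (norm (lam k))\<^sup>2
      + 3 / 4 * \<alpha> * (norm (lam (Suc k) - lam k))\<^sup>2"
  using w_descent[of k] y_descent[of k] multiplier_ascent[of k] by linarith

text \<open>
  With \<open>a\<close> and \<open>D\<close> the new and old multiplier increments and \<open>s\<close>, \<open>t\<close> those of \<open>w\<close> and \<open>y\<close>, the
  update gives \<open>a = D / 2 + \<rho> (s - t)\<close>. Two consecutive subgradient inequalities give
  \<open>a \<bullet> t \<ge> 0\<close>, so taking the inner product with \<open>a\<close> eliminates the increment of \<open>y\<close>.
\<close>
lemma multiplier_increment: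
  "\<alpha> * (norm (lam (Suc (Suc k)) - lam (Suc k)))\<^sup>2
    \<le> \<alpha> / 2 * (norm (lam (Suc k) - lam k))\<^sup>2 + \<rho> * (norm (w (Suc (Suc k)) - w (Suc k)))\<^sup>2"
proof -
  define a where "a = lam (Suc (Suc k)) - lam (Suc k)"
  define D where "D = lam (Suc k) - lam k"
  define s where "s = w (Suc (Suc k)) - w (Suc k)"
  define t where "t = y (Suc (Suc k)) - y (Suc k)"
  have "a = (1 / 2) *\<^sub>R D + \<rho> *\<^sub>R (s - t)"
    unfolding a_def D_def s_def t_def lam_step[of "Suc k"] lam_step[of k]
    by (simp add: algebra_simps)
  then have "a \<bullet> a = a \<bullet> ((1 / 2) *\<^sub>R D + \<rho> *\<^sub>R (s - t))" by simp
  then have "a \<bullet> a = (1 / 2) * (a \<bullet> D) + \<rho> * (a \<bullet> s) - \<rho> * (a \<bullet> t)"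
    by (simp add: inner_simps algebra_simps)
  moreover have "0 \<le> a \<bullet> t"
    using multiplier_subgradient[OF y_in[of "Suc k"], of "Suc k"]
      multiplier_subgradient[OF y_in[of "Suc (Suc k)"], of k]
    unfolding a_def t_def by (simp add: inner_simps)
  then have "0 \<le> \<rho> * (a \<bullet> t)" using \<rho>_pos by simp
  moreover have "0 \<le> a \<bullet> a - 2 * (a \<bullet> D) + D \<bullet> D"
    using inner_ge_zero[of "a - D"] by (simp add: inner_simps inner_commute)
  moreover have "0 \<le> (1 / 4) * (a \<bullet> a) - \<rho> * (a \<bullet> s) + \<rho>\<^sup>2 * (s \<bullet> s)"
    using inner_ge_zero[of "(1 / 2) *\<^sub>R a - \<rho> *\<^sub>R s"]
    by (simp add: inner_simps inner_commute power2_eq_square algebra_simps)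
  ultimately have "a \<bullet> a \<le> (1 / 2) * (D \<bullet> D) + 2 * (\<rho>\<^sup>2 * (s \<bullet> s))"
    by linarith
  then have "\<alpha> * (a \<bullet> a) \<le> \<alpha> * ((1 / 2) * (D \<bullet> D) + 2 * (\<rho>\<^sup>2 * (s \<bullet> s)))"
    using \<alpha>_pos by (intro mult_left_mono) auto
  also have "\<dots> = \<alpha> / 2 * (D \<bullet> D) + 2 * (\<rho> * \<alpha>) * \<rho> * (s \<bullet> s)"
    by (simp add: algebra_simps power2_eq_square)
  also have "\<dots> = \<alpha> / 2 * (D \<bullet> D) + \<rho> * (s \<bullet> s)"
    by (simp add: \<rho>\<alpha>)
  finally show ?thesis
    by (simp add: a_def D_def s_def power2_norm_eq_inner)
qed

text \<open>
  The weight \<open>c\<close> of the squared multiplier increment has to absorb \<open>3 / 4 * \<alpha>\<close> from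
  \<open>multiplier_ascent\<close> through the factor \<open>1 / 2\<close> of \<open>multiplier_increment\<close>, which requires
  \<open>(c + 3 / 4 * \<alpha>) / 2 < c\<close>, while the resulting \<open>(c / \<alpha> + 3 / 4) * \<rho>\<close> in front of the increment of
  \<open>w\<close> must stay below \<open>\<mu> / 2\<close>, known to exceed \<open>2 * \<rho>\<close>. The choice \<open>c = \<alpha>\<close> satisfies both strictly.
  The index is shifted because monotonicity starts with the pair \<open>y 1\<close>, \<open>y 2\<close>.
\<close>
definition merit :: "nat \<Rightarrow> real" where
  "merit k = lagrangian (w (Suc k)) (y (Suc k)) (lam (Suc k))
     + \<alpha> / 4 * (norm (lam (Suc k)))\<^sup>2 + \<alpha> * (norm (lam (Suc k) - lam k))\<^sup>2"

lemma \<mu>_half: "2 * \<rho> \<le> \<mu> / 2"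
  using \<mu>_large by (simp add: \<rho>_eq)

lemma merit_decrease:
  "merit (Suc k) + \<alpha> / 8 * (norm (lam (Suc k) - lam k))\<^sup>2
      + \<rho> / 4 * (norm (w (Suc (Suc k)) - w (Suc k)))\<^sup>2
      + \<rho> / 2 * (norm (y (Suc (Suc k)) - y (Suc k)))\<^sup>2 \<le> merit k"
proof -
  have "2 * \<rho> * (norm (w (Suc (Suc k)) - w (Suc k)))\<^sup>2
      \<le> \<mu> / 2 * (norm (w (Suc (Suc k)) - w (Suc k)))\<^sup>2"
    using \<mu>_half by (intro mult_right_mono) auto
  then show ?thesis
    using step_estimate[of "Suc k"] multiplier_increment[of k]
    unfolding merit_def by (simp only: mult.assoc)
qed

lemma merit_decseq: "decseq merit"
proof (rule decseq_SucI)
  fix k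
  have "0 \<le> \<alpha> / 8 * (norm (lam (Suc k) - lam k))\<^sup>2"
    "0 \<le> \<rho> / 4 * (norm (w (Suc (Suc k)) - w (Suc k)))\<^sup>2"
    "0 \<le> \<rho> / 2 * (norm (y (Suc (Suc k)) - y (Suc k)))\<^sup>2"
    using \<alpha>_pos \<rho>_pos by simp_all
  then show "merit (Suc k) \<le> merit k"
    using merit_decrease[of k] by linarith
qed

section \<open>Cluster points\<close>

lemma bounded_multipliers:
  assumes "bounded (range w)" "bounded (range y)"
  shows "bounded (range lam)"
proof -
  obtain B where B: "\<And>k. norm (w k) \<le> B" using assms(1) by (auto simp: bounded_iff)
  obtain C where C: "\<And>k. norm (y k) \<le> C" using assms(2) by (auto simp: bounded_iff)
  define K where "K = norm (lam 0) + 2 * \<rho> * (B + C)"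
  have pos: "0 \<le> \<rho> * (B + C)"
    using \<rho>_pos B[of 0] C[of 0] norm_ge_zero[of "w 0"] norm_ge_zero[of "y 0"]
    by (intro mult_nonneg_nonneg) linarith+
  have "norm (lam k) \<le> K" for k
  proof (induction k)
    case 0
    then show ?case using pos by (simp add: K_def)
  next
    case (Suc k)
    have "norm (lam (Suc k)) \<le> norm ((1 / 2) *\<^sub>R lam k) + norm (\<rho> *\<^sub>R (w (Suc k) - y (Suc k)))"
      unfolding lam_step by (rule norm_triangle_ineq)
    also have "\<dots> \<le> (1 / 2) * K + \<rho> * (B + C)"
    proof (rule add_mono)
      have "norm (w (Suc k) - y (Suc k)) \<le> B + C"
        using norm_triangle_ineq4[of "w (Suc k)" "y (Suc k)"] B[of "Suc k"] C[of "Suc k"] by linarith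
      then show "norm (\<rho> *\<^sub>R (w (Suc k) - y (Suc k))) \<le> \<rho> * (B + C)"
        using \<rho>_pos by simp
    qed (use Suc in simp)
    also have "\<dots> \<le> K" unfolding K_def by (simp add: field_simps)
    finally show ?case .
  qed
  then show ?thesis by (auto simp: bounded_iff)
qed

text \<open>
  Compactness alone does not relate \<open>lam (Suc (s i))\<close> to \<open>lam (s i)\<close>; the limits agree because the
  merit function is monotone and bounded below, so that its decrements, and with them all
  increments of the iterates, tend to 0. The limits of both indices are needed to pass to the
  limit in the optimality conditions.
\<close>
lemma convergent_subsequence:
  assumes "bounded (range w)" "bounded (range y)"
  obtains s :: "nat \<Rightarrow> nat" and ws ys lams where "strict_mono s"
    "(\<lambda>i. w (Suc (s i))) \<longlonglongrightarrow> ws" "(\<lambda>i. y (Suc (s i))) \<longlonglongrightarrow> ys"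
    "(\<lambda>i. lam (Suc (s i))) \<longlonglongrightarrow> lams"
    "(\<lambda>i. w (s i)) \<longlonglongrightarrow> ws" "(\<lambda>i. y (s i)) \<longlonglongrightarrow> ys" "(\<lambda>i. lam (s i)) \<longlonglongrightarrow> lams"
proof -
  \<comment> \<open>Starting two steps later leaves room to go back one step, where the decrements of the merit
    function, which concern the steps from index 1 on, still apply.\<close>
  let ?x = "\<lambda>k. (w (Suc (Suc k)), y (Suc (Suc k)), lam (Suc (Suc k)))"
  have "range ?x \<subseteq> range w \<times> range y \<times> range lam" by auto
  moreover have "bounded (range w \<times> range y \<times> range lam)"
    by (intro bounded_Times assms bounded_multipliers)
  ultimately have "bounded (range ?x)" by (rule bounded_subset[rotated])
  then obtain x s where s: "strict_mono s" and "(?x \<circ> s) \<longlonglongrightarrow> x"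
    using bounded_imp_convergent_subsequence by blast
  moreover obtain ws ys lams where "x = (ws, ys, lams)" by (cases x)
  ultimately have lim: "(\<lambda>i. ?x (s i)) \<longlonglongrightarrow> (ws, ys, lams)" by (simp add: o_def)
  have w: "(\<lambda>i. w (Suc (Suc (s i)))) \<longlonglongrightarrow> ws"
    and y: "(\<lambda>i. y (Suc (Suc (s i)))) \<longlonglongrightarrow> ys"
    and lam: "(\<lambda>i. lam (Suc (Suc (s i)))) \<longlonglongrightarrow> lams"
    using tendsto_fst[OF lim] tendsto_fst[OF tendsto_snd[OF lim]] tendsto_snd[OF tendsto_snd[OF lim]]
    by simp_all
  let ?q = "\<lambda>u v q. lagrangian u v q + \<alpha> / 4 * (norm q)\<^sup>2"
  have "(\<lambda>i. ?q (w (Suc (Suc (s i)))) (y (Suc (Suc (s i)))) (lam (Suc (Suc (s i)))))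
      \<longlonglongrightarrow> ?q ws ys lams"
    unfolding lagrangian_def
    by (intro tendsto_intros w y lam continuous_on_tendsto_compose[OF cont_h w]
        continuous_on_tendsto_compose[OF cont_p y]) auto
  then obtain K where K: "\<And>i. \<bar>?q (w (Suc (Suc (s i)))) (y (Suc (Suc (s i)))) (lam (Suc (Suc (s i))))\<bar> \<le> K"
    using convergent_imp_bounded by (fastforce simp: bounded_iff)
  define c where "c = - K"
  have c: "c \<le> ?q (w (Suc (Suc (s i)))) (y (Suc (Suc (s i)))) (lam (Suc (Suc (s i))))" for i
    using K[of i] unfolding c_def by linarith
  \<comment> \<open>The last term of the merit function is nonnegative, and monotonicity carries the lower bound
    from the subsequence to all indices.\<close>
  have "c \<le> merit k" for k
  proof -
    have "c \<le> merit (Suc (s k))"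
      using c[of k] \<alpha>_pos unfolding merit_def by (simp add: add_increasing2)
    also have "\<dots> \<le> merit k"
      using merit_decseq seq_suble[OF s, of k] by (auto simp: decseq_def)
    finally show ?thesis .
  qed
  then obtain m where m: "merit \<longlonglongrightarrow> m"
    using decseq_convergent[OF merit_decseq] by blast
  have gap: "(\<lambda>k. merit k - merit (Suc k)) \<longlonglongrightarrow> 0"
    using tendsto_diff[OF m LIMSEQ_Suc[OF m]] by simp
  have vanish: "x \<longlonglongrightarrow> 0"
    if "C > 0" "\<And>k. C * (norm (x k))\<^sup>2 \<le> merit k - merit (Suc k)" for C and x :: "nat \<Rightarrow> 'a"
  proof -
    have "(\<lambda>k. (merit k - merit (Suc k)) / C) \<longlonglongrightarrow> 0 / C"
      using gap by (intro tendsto_intros) (use that in auto)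
    then have upper: "(\<lambda>k. (merit k - merit (Suc k)) / C) \<longlonglongrightarrow> 0" by simp
    have "(norm (x k))\<^sup>2 \<le> (merit k - merit (Suc k)) / C" for k
      using that(2)[of k] that(1) by (simp add: pos_le_divide_eq mult.commute)
    then have "(\<lambda>k. (norm (x k))\<^sup>2) \<longlonglongrightarrow> 0"
      by (intro tendsto_sandwich[OF _ _ tendsto_const upper]) simp_all
    then show ?thesis
      using tendsto_real_sqrt[of "\<lambda>k. (norm (x k))\<^sup>2"] by (simp add: tendsto_norm_zero_iff)
  qed
  have nonneg: "0 \<le> \<alpha> / 8 * (norm (lam (Suc k) - lam k))\<^sup>2"
    "0 \<le> \<rho> / 4 * (norm (w (Suc (Suc k)) - w (Suc k)))\<^sup>2"
    "0 \<le> \<rho> / 2 * (norm (y (Suc (Suc k)) - y (Suc k)))\<^sup>2" for k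
    using \<alpha>_pos \<rho>_pos by simp_all
  have dlam: "(\<lambda>k. lam (Suc k) - lam k) \<longlonglongrightarrow> 0"
  proof (rule vanish)
    show "0 < \<alpha> / 8" using \<alpha>_pos by simp
    show "\<alpha> / 8 * (norm (lam (Suc k) - lam k))\<^sup>2 \<le> merit k - merit (Suc k)" for k
      using merit_decrease[of k] nonneg[of k] by linarith
  qed
  have dw: "(\<lambda>k. w (Suc (Suc k)) - w (Suc k)) \<longlonglongrightarrow> 0"
  proof (rule vanish)
    show "0 < \<rho> / 4" using \<rho>_pos by simp
    show "\<rho> / 4 * (norm (w (Suc (Suc k)) - w (Suc k)))\<^sup>2 \<le> merit k - merit (Suc k)" for k
      using merit_decrease[of k] nonneg[of k] by linarith
  qed
  have dy: "(\<lambda>k. y (Suc (Suc k)) - y (Suc k)) \<longlonglongrightarrow> 0"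
  proof (rule vanish)
    show "0 < \<rho> / 2" using \<rho>_pos by simp
    show "\<rho> / 2 * (norm (y (Suc (Suc k)) - y (Suc k)))\<^sup>2 \<le> merit k - merit (Suc k)" for k
      using merit_decrease[of k] nonneg[of k] by linarith
  qed
  show thesis
  proof (rule that[of "\<lambda>i. Suc (s i)"])
    show "strict_mono (\<lambda>i. Suc (s i))" using s by (simp add: strict_mono_def)
    show "(\<lambda>i. w (Suc (s i))) \<longlonglongrightarrow> ws"
      using tendsto_diff[OF w LIMSEQ_subseq_LIMSEQ[OF dw s]] by (simp add: o_def)
    show "(\<lambda>i. y (Suc (s i))) \<longlonglongrightarrow> ys"
      using tendsto_diff[OF y LIMSEQ_subseq_LIMSEQ[OF dy s]] by (simp add: o_def)
    show "(\<lambda>i. lam (Suc (s i))) \<longlonglongrightarrow> lams"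
      using tendsto_diff[OF lam LIMSEQ_subseq_LIMSEQ[OF LIMSEQ_Suc[OF dlam] s]] by (simp add: o_def)
  qed (use w y lam in auto)
qed

text \<open>
  Both minimisation problems are closed under limits. For \<open>w\<close>, expanding the penalty around the
  limit \<open>ws\<close> contributes the slope \<open>\<rho> * (ws - ys) = lams / 2\<close>, which together with the half
  multiplier in the Lagrangian yields \<open>lams\<close>.
\<close>
lemma cluster_point_stationary:
  assumes w1: "(\<lambda>i. w (Suc (s i))) \<longlonglongrightarrow> ws" and y1: "(\<lambda>i. y (Suc (s i))) \<longlonglongrightarrow> ys"
    and lam1: "(\<lambda>i. lam (Suc (s i))) \<longlonglongrightarrow> lams"
    and w0: "(\<lambda>i. w (s i)) \<longlonglongrightarrow> ws" and y0: "(\<lambda>i. y (s i)) \<longlonglongrightarrow> ys"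
    and lam0: "(\<lambda>i. lam (s i)) \<longlonglongrightarrow> lams"
  shows limit_residual: "ws - ys = \<alpha> *\<^sub>R lams"
    and limit_in: "ws \<in> Z" "ys \<in> Y"
    and limit_w: "- lams \<in> limiting_subdifferential (\<lambda>u. ereal (h u) + indicator_fun Z u) ws"
    and limit_y: "lams \<in> limiting_subdifferential (\<lambda>v. ereal (p v) + indicator_fun Y v) ys"
proof -
  have "(\<lambda>i. w (Suc (s i)) - y (Suc (s i))) \<longlonglongrightarrow> \<alpha> *\<^sub>R (2 *\<^sub>R lams - lams)"
    unfolding residual by (intro tendsto_intros lam1 lam0)
  moreover have "2 *\<^sub>R lams - lams = lams" by (simp add: scaleR_2)
  ultimately show res: "ws - ys = \<alpha> *\<^sub>R lams"
    using LIMSEQ_unique[OF tendsto_diff[OF w1 y1]] by simp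
  show ws: "ws \<in> Z" by (rule closed_sequentially[OF closed_Z _ w1]) (rule w_in)
  show ys: "ys \<in> Y" by (rule closed_sequentially[OF closed_Y _ y1]) (rule y_in)
  have h: "(\<lambda>i. h (w (Suc (s i)))) \<longlonglongrightarrow> h ws"
    by (rule continuous_on_tendsto_compose[OF cont_h w1]) auto
  have p: "(\<lambda>i. p (y (Suc (s i)))) \<longlonglongrightarrow> p ys"
    by (rule continuous_on_tendsto_compose[OF cont_p y1]) auto
  show "- lams \<in> limiting_subdifferential (\<lambda>u. ereal (h u) + indicator_fun Z u) ws"
  proof (rule quadratic_minorant_imp_limiting_subgradient[OF ws])
    fix u assume u: "u \<in> Z"
    have "h ws + (1 / 2) * (lams \<bullet> ws) + \<rho> / 2 * (norm (ws - ys))\<^sup>2 + \<mu> / 2 * (norm (ws - ws))\<^sup>2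
        \<le> h u + (1 / 2) * (lams \<bullet> u) + \<rho> / 2 * (norm (u - ys))\<^sup>2 + \<mu> / 2 * (norm (u - ws))\<^sup>2"
    proof (rule LIMSEQ_le)
      show "(\<lambda>i. h (w (Suc (s i))) + (1 / 2) * (lam (s i) \<bullet> w (Suc (s i)))
          + \<rho> / 2 * (norm (w (Suc (s i)) - y (s i)))\<^sup>2 + \<mu> / 2 * (norm (w (Suc (s i)) - w (s i)))\<^sup>2)
        \<longlonglongrightarrow> h ws + (1 / 2) * (lams \<bullet> ws) + \<rho> / 2 * (norm (ws - ys))\<^sup>2 + \<mu> / 2 * (norm (ws - ws))\<^sup>2"
        by (intro tendsto_intros h w1 w0 y0 lam0)
      show "(\<lambda>i. h u + (1 / 2) * (lam (s i) \<bullet> u)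
          + \<rho> / 2 * (norm (u - y (s i)))\<^sup>2 + \<mu> / 2 * (norm (u - w (s i)))\<^sup>2)
        \<longlonglongrightarrow> h u + (1 / 2) * (lams \<bullet> u) + \<rho> / 2 * (norm (u - ys))\<^sup>2 + \<mu> / 2 * (norm (u - ws))\<^sup>2"
        by (intro tendsto_intros w0 y0 lam0)
    qed (use w_min[OF u] in blast)
    moreover have "\<rho> / 2 * (norm (u - ys))\<^sup>2 = \<rho> / 2 * (norm (ws - ys))\<^sup>2
        + (1 / 2) * (lams \<bullet> (u - ws)) + \<rho> / 2 * (norm (u - ws))\<^sup>2"
    proof -
      have "ys - ws = - (\<alpha> *\<^sub>R lams)" using res by (simp add: algebra_simps)
      then have "(norm (ys - u))\<^sup>2
          = (norm (ys - ws))\<^sup>2 + 2 * (\<alpha> * (lams \<bullet> (u - ws))) + (norm (u - ws))\<^sup>2"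
        unfolding power2_norm_diff_expand[of ys u ws] by (simp only: inner_minus_left inner_scaleR_left)
      then have "\<rho> / 2 * (norm (ys - u))\<^sup>2 = \<rho> / 2 * (norm (ys - ws))\<^sup>2
          + (\<rho> * \<alpha>) * (lams \<bullet> (u - ws)) + \<rho> / 2 * (norm (u - ws))\<^sup>2"
        by (simp only: distrib_left)
      then show ?thesis by (simp add: \<rho>\<alpha> norm_minus_commute)
    qed
    ultimately show "h ws + - lams \<bullet> (u - ws) - (\<rho> / 2 + \<mu> / 2) * (norm (u - ws))\<^sup>2 \<le> h u"
      unfolding inner_diff_right inner_minus_left diff_self norm_zero power_zero_numeral
        mult_zero_right distrib_right
      by argo
  qed
  show "lams \<in> limiting_subdifferential (\<lambda>v. ereal (p v) + indicator_fun Y v) ys"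
  proof (rule quadratic_minorant_imp_limiting_subgradient[OF ys])
    fix v assume v: "v \<in> Y"
    have "(\<lambda>i. p (y (Suc (s i))) + lam (Suc (s i)) \<bullet> (v - y (Suc (s i))))
        \<longlonglongrightarrow> p ys + lams \<bullet> (v - ys)"
      by (intro tendsto_intros p y1 lam1)
    then have "p ys + lams \<bullet> (v - ys) \<le> p v"
      by (rule LIMSEQ_le_const2) (use multiplier_subgradient[OF v] in blast)
    then show "p ys + lams \<bullet> (v - ys) - 0 * (norm (v - ys))\<^sup>2 \<le> p v" by simp
  qed
qed

section \<open>The bound on the limit multiplier\<close>

lemma merit_limit_le:
  assumes w1: "(\<lambda>i. w (Suc (s i))) \<longlonglongrightarrow> ws" and y1: "(\<lambda>i. y (Suc (s i))) \<longlonglongrightarrow> ys"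
    and lam1: "(\<lambda>i. lam (Suc (s i))) \<longlonglongrightarrow> lams"
    and lam0: "(\<lambda>i. lam (s i)) \<longlonglongrightarrow> lams"
    and res: "ws - ys = \<alpha> *\<^sub>R lams"
  shows "h ws + p ys + \<alpha> / 2 * (norm lams)\<^sup>2 \<le> merit 0"
proof -
  have "(\<lambda>i. merit (s i)) \<longlonglongrightarrow> lagrangian ws ys lams
      + \<alpha> / 4 * (norm lams)\<^sup>2 + \<alpha> * (norm (lams - lams))\<^sup>2"
    unfolding merit_def lagrangian_def
    by (intro tendsto_intros w1 y1 lam1 lam0 continuous_on_tendsto_compose[OF cont_h w1]
        continuous_on_tendsto_compose[OF cont_p y1]) auto
  then have "lagrangian ws ys lams + \<alpha> / 4 * (norm lams)\<^sup>2 + \<alpha> * (norm (lams - lams))\<^sup>2 \<le> merit 0"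
    by (rule LIMSEQ_le_const2) (use merit_decseq in \<open>auto simp: decseq_def\<close>)
  moreover have "lagrangian ws ys lams = h ws + p ys + \<rho> * \<alpha> / 2 * (\<alpha> * (norm lams)\<^sup>2)"
    unfolding lagrangian_def res by (simp add: power_mult_distrib power2_eq_square)
  ultimately show ?thesis by (simp add: \<rho>\<alpha>)
qed

text \<open>
  The first multiplier increment is \<open>\<rho> * (s - t) - lam 0 / 2\<close> and is bounded by the increments \<open>s\<close>
  of \<open>w\<close> and \<open>t\<close> of \<open>y\<close>. These obey a budget: the first two minimisations spend
  \<open>\<mu> / 2 * (norm s)\<^sup>2 + \<rho> / 2 * (norm t)\<^sup>2\<close> of a Lagrangian that cannot fall below
  \<open>l - \<alpha> * (norm (lam 0))\<^sup>2\<close>.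
\<close>
lemma merit_start_le:
  assumes start: "w 0 = y 0"
    and low: "\<And>u v. u \<in> Z \<Longrightarrow> v \<in> Y \<Longrightarrow> l \<le> h u + p v + \<sigma> / 2 * (norm (u - v))\<^sup>2"
    and \<sigma>: "2 * \<sigma> \<le> \<rho>"
  shows "merit 0 - l \<le> 21 / 4 * (h (w 0) + p (y 0) - l) + 51 / 16 * \<alpha> * (norm (lam 0))\<^sup>2"
proof -
  define r where "r = w 1 - y 1"
  define s where "s = w 1 - w 0"
  define t where "t = y 1 - y 0"
  define D where "D = lam 1 - lam 0"
  define H where "H = h (w 0) + p (y 0)"
  have L0: "lagrangian (w 0) (y 0) (lam 0) = H - \<alpha> / 2 * (norm (lam 0))\<^sup>2"
    unfolding lagrangian_def H_def using start by (simp add: power2_norm_eq_inner)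
  have descent: "lagrangian (w 1) (y 1) (lam 0) + \<mu> / 2 * (norm s)\<^sup>2 + \<rho> / 2 * (norm t)\<^sup>2
      \<le> H - \<alpha> / 2 * (norm (lam 0))\<^sup>2"
    using w_descent[of 0] y_descent[of 0] L0 unfolding s_def t_def by simp
  have "l - \<alpha> * (norm (lam 0))\<^sup>2 \<le> lagrangian (w 1) (y 1) (lam 0)"
  proof -
    \<comment> \<open>Half of the penalty pays for \<open>\<sigma>\<close>, and this square uses the other half to absorb the linear
      term.\<close>
    have "0 \<le> \<alpha> / 2 * (norm (lam 0 + \<rho> *\<^sub>R r))\<^sup>2" using \<alpha>_pos by simp
    also have "\<dots> = \<alpha> / 2 * (norm (lam 0))\<^sup>2 + (\<rho> * \<alpha>) * (lam 0 \<bullet> r)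
        + (\<rho> * \<alpha>) * \<rho> / 2 * (norm r)\<^sup>2"
      by (simp add: power2_norm_eq_inner inner_simps inner_commute algebra_simps)
    also have "\<dots> = \<alpha> / 2 * (norm (lam 0))\<^sup>2 + 1 / 2 * (lam 0 \<bullet> r) + \<rho> / 4 * (norm r)\<^sup>2"
      by (simp add: \<rho>\<alpha>)
    finally have young: "0 \<le> \<dots>" .
    have "l \<le> h (w 1) + p (y 1) + \<sigma> / 2 * (norm r)\<^sup>2"
      unfolding r_def by (rule low[OF w_in y_in])
    moreover have "\<sigma> / 2 * (norm r)\<^sup>2 \<le> \<rho> / 4 * (norm r)\<^sup>2"
      using \<sigma> by (intro mult_right_mono) auto
    moreover have "lagrangian (w 1) (y 1) (lam 0) = h (w 1) + p (y 1) + 1 / 2 * (lam 0 \<bullet> r)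
        - \<alpha> / 2 * (norm (lam 0))\<^sup>2 + \<rho> / 2 * (norm r)\<^sup>2"
      unfolding lagrangian_def r_def by (simp add: power2_norm_eq_inner inner_simps algebra_simps)
    ultimately show ?thesis using young by linarith
  qed
  with descent have budget: "\<mu> / 2 * (norm s)\<^sup>2 + \<rho> / 2 * (norm t)\<^sup>2
      \<le> H - l + \<alpha> / 2 * (norm (lam 0))\<^sup>2"
    by linarith
  have \<mu>s: "2 * \<rho> * (norm s)\<^sup>2 \<le> \<mu> / 2 * (norm s)\<^sup>2"
    using \<mu>_half by (intro mult_right_mono) auto
  have D_le: "\<alpha> * (norm D)\<^sup>2 \<le> 3 / 4 * \<alpha> * (norm (lam 0))\<^sup>2
      + 3 / 2 * \<rho> * (norm s)\<^sup>2 + 3 / 2 * \<rho> * (norm t)\<^sup>2"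
  proof -
    define a b c where "a = (1 / 2) *\<^sub>R lam 0" and "b = \<rho> *\<^sub>R s" and "c = \<rho> *\<^sub>R t"
    have "D = b - a - c"
    proof -
      have "lam 0 = a + a" unfolding a_def by (simp flip: scaleR_add_left)
      then show ?thesis
        unfolding D_def b_def c_def s_def t_def using lam_step[of 0] start
        by (simp add: a_def[symmetric] scaleR_diff_right)
    qed
    moreover have "0 \<le> (a + b) \<bullet> (a + b)" "0 \<le> (b + c) \<bullet> (b + c)" "0 \<le> (a - c) \<bullet> (a - c)"
      by simp_all
    ultimately have "D \<bullet> D \<le> 3 * (a \<bullet> a + b \<bullet> b + c \<bullet> c)"
      by (simp add: inner_simps inner_commute)
    then have "\<alpha> * (D \<bullet> D) \<le> \<alpha> * (3 * (a \<bullet> a + b \<bullet> b + c \<bullet> c))"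
      using \<alpha>_pos by (intro mult_left_mono) auto
    also have "\<dots> = 3 / 4 * \<alpha> * (lam 0 \<bullet> lam 0)
        + 3 * (\<rho> * \<alpha>) * \<rho> * (s \<bullet> s) + 3 * (\<rho> * \<alpha>) * \<rho> * (t \<bullet> t)"
      unfolding a_def b_def c_def by (simp add: algebra_simps)
    finally show ?thesis by (simp add: \<rho>\<alpha> power2_norm_eq_inner)
  qed
  have "merit 0 \<le> H - \<alpha> / 4 * (norm (lam 0))\<^sup>2 + 7 / 4 * (\<alpha> * (norm D)\<^sup>2)
      - \<mu> / 2 * (norm s)\<^sup>2 - \<rho> / 2 * (norm t)\<^sup>2"
    using step_estimate[of 0] L0 unfolding merit_def D_def s_def t_def by simp
  also have "\<dots> \<le> H + 17 / 16 * \<alpha> * (norm (lam 0))\<^sup>2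
      + 21 / 8 * \<rho> * (norm s)\<^sup>2 - \<mu> / 2 * (norm s)\<^sup>2 + 17 / 8 * \<rho> * (norm t)\<^sup>2"
    using D_le by (simp add: algebra_simps)
  \<comment> \<open>The factor is dictated by \<open>t\<close>: \<open>17 / 4 * (\<rho> / 2) = 17 / 8 * \<rho>\<close>. For \<open>s\<close> there is slack, as
    \<open>\<mu> / 2 \<ge> 2 * \<rho>\<close>.\<close>
  also have "\<dots> \<le> H + 17 / 16 * \<alpha> * (norm (lam 0))\<^sup>2
      + 17 / 4 * (\<mu> / 2 * (norm s)\<^sup>2 + \<rho> / 2 * (norm t)\<^sup>2)"
  proof -
    have "0 \<le> \<rho> * (norm s)\<^sup>2" using \<rho>_pos by simp
    then show ?thesis using \<mu>s by (simp only: mult.assoc distrib_left)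
  qed
  also have "\<dots> \<le> H + 17 / 16 * \<alpha> * (norm (lam 0))\<^sup>2
      + 17 / 4 * (H - l + \<alpha> / 2 * (norm (lam 0))\<^sup>2)"
    using budget by (intro add_left_mono mult_left_mono) auto
  finally show ?thesis unfolding H_def by argo
qed

text \<open>
  In the limit the residual is \<open>\<alpha> *\<^sub>R lams\<close>, so the penalised lower bound takes at most \<open>\<alpha> / 8\<close> of
  the coefficient \<open>\<alpha> / 2\<close> of \<open>(norm lams)\<^sup>2\<close>; the remaining \<open>3 / 8 * \<alpha>\<close> is controlled by the initial
  merit.
\<close>
lemma limit_multiplier_bound:
  assumes start: "w 0 = y 0"
    and low: "\<And>u v. u \<in> Z \<Longrightarrow> v \<in> Y \<Longrightarrow> l \<le> h u + p v + \<sigma> / 2 * (norm (u - v))\<^sup>2"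
    and \<sigma>: "2 * \<sigma> \<le> \<rho>"
    and limit: "h ws + p ys + \<alpha> / 2 * (norm lams)\<^sup>2 \<le> merit 0" "ws - ys = \<alpha> *\<^sub>R lams"
      "ws \<in> Z" "ys \<in> Y"
  shows "\<alpha> * (norm lams)\<^sup>2 \<le> 14 * (h (w 0) + p (y 0) - l) + 17 / 2 * \<alpha> * (norm (lam 0))\<^sup>2"
proof -
  have "l \<le> h ws + p ys + \<sigma> / 2 * (norm (ws - ys))\<^sup>2" by (rule low[OF limit(3,4)])
  moreover have "\<sigma> / 2 * (norm (ws - ys))\<^sup>2 \<le> \<rho> / 4 * (norm (ws - ys))\<^sup>2"
    using \<sigma> by (intro mult_right_mono) auto
  moreover have "\<rho> / 4 * (norm (ws - ys))\<^sup>2 = (\<rho> * \<alpha>) / 4 * (\<alpha> * (norm lams)\<^sup>2)"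
    unfolding limit(2) by (simp add: power_mult_distrib power2_eq_square)
  ultimately have "l + 3 / 8 * (\<alpha> * (norm lams)\<^sup>2) \<le> merit 0"
    using limit(1) unfolding \<rho>\<alpha> by simp
  moreover have "merit 0 - l
      \<le> 21 / 4 * (h (w 0) + p (y 0) - l) + 51 / 16 * \<alpha> * (norm (lam 0))\<^sup>2"
    by (rule merit_start_le[OF start low \<sigma>])
  ultimately show ?thesis by argo
qed

end

section \<open>The quadratic instance\<close>

lemma continuous_on_h_fun: "continuous_on UNIV (h_fun M d \<gamma>)"
proof -
  have "continuous_on UNIV (\<lambda>x :: 'a triple. M *v (fst x - fst (snd x)))"
    by (rule linear_continuous_on_compose[where g = "\<lambda>x. M *v x"])
      (auto intro!: continuous_intros)
  then show ?thesis
    unfolding h_fun_def f_Q_def case_prod_beta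
    by (intro continuous_intros continuous_on_component)
qed

lemma continuous_on_p_fun:
  assumes "continuously_differentiable g"
  shows "continuous_on UNIV (p_fun g)"
proof -
  have "continuous_on UNIV g"
    using assms unfolding continuously_differentiable_def
    by (meson has_derivative_continuous continuous_at_imp_continuous_on)
  then show ?thesis
    unfolding p_fun_def case_prod_beta
    by (rule continuous_on_compose2) (auto intro!: continuous_intros)
qed

lemma closed_Z1: "closed (Z1 :: 'n::finite triple set)"
proof -
  have "Z1 = {x :: 'n triple. (fst x + fst (snd x)) \<bullet> snd (snd x) = 0}"
    unfolding Z1_def by auto
  also have "closed \<dots>" by (intro closed_Collect_eq continuous_intros)
  finally show ?thesis .
qed

lemma closed_Z2: "closed (Z2 A b)"
proof -
  have "Z2 A b = {x. (\<forall>i. 0 \<le> fst x $ i) \<and> (\<forall>i. 0 \<le> fst (snd x) $ i) \<and>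
      (\<forall>i. 0 \<le> snd (snd x) $ i \<and> snd (snd x) $ i \<le> 1) \<and>
      (\<forall>j. b $ j \<le> (A *v (fst x - fst (snd x))) $ j)}"
    unfolding Z2_def by auto
  also have "closed \<dots>"
    by (intro closed_Collect_conj closed_Collect_all closed_Collect_le continuous_intros
        continuous_on_component
        continuous_on_compose2[OF linear_continuous_on[of "\<lambda>x. A *v x" UNIV]]) auto
  finally show ?thesis .
qed

lemma convex_Z2: "convex (Z2 A b)"
proof (rule convexI)
  fix x z :: "'a triple" and s t :: real
  assume st: "0 \<le> s" "0 \<le> t" "s + t = 1" and x: "x \<in> Z2 A b" and z: "z \<in> Z2 A b"
  obtain x1 x2 x3 where x_eq: "x = (x1, x2, x3)" by (cases x)
  obtain z1 z2 z3 where z_eq: "z = (z1, z2, z3)" by (cases z)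
  have mix: "c \<le> s * a + t * e" if "c \<le> a" "c \<le> e" for a c e :: real
    using that st mult_left_mono[of c a s] mult_left_mono[of c e t] distrib_right[of s t c] by simp
  have mix': "s * a + t * e \<le> c" if "a \<le> c" "e \<le> c" for a c e :: real
    using that st mult_left_mono[of a c s] mult_left_mono[of e c t] distrib_right[of s t c] by simp
  have "A *v ((s *\<^sub>R x1 + t *\<^sub>R z1) - (s *\<^sub>R x2 + t *\<^sub>R z2))
      = s *\<^sub>R (A *v (x1 - x2)) + t *\<^sub>R (A *v (z1 - z2))"
    by (simp add: matrix_vector_mult_diff_distrib matrix_vector_right_distrib
        matrix_vector_mult_scaleR algebra_simps)
  then show "s *\<^sub>R x + t *\<^sub>R z \<in> Z2 A b"
    using x z unfolding x_eq z_eq Z2_def by (auto intro!: mix mix')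
qed

lemma convex_on_p_fun:
  fixes g :: "real ^ 'n::finite \<Rightarrow> real"
  assumes g: "convex_on UNIV g" and S: "convex S"
  shows "convex_on S (p_fun g)"
proof (rule convex_onI[OF _ S])
  fix t :: real and x z :: "'n triple"
  assume t: "0 < t" "t < 1"
  obtain x1 x2 x3 where x_eq: "x = (x1, x2, x3)" by (cases x)
  obtain z1 z2 z3 where z_eq: "z = (z1, z2, z3)" by (cases z)
  have "(1 - t) *\<^sub>R x1 + t *\<^sub>R z1 - ((1 - t) *\<^sub>R x2 + t *\<^sub>R z2)
      = (1 - t) *\<^sub>R (x1 - x2) + t *\<^sub>R (z1 - z2)"
    by (simp add: algebra_simps)
  then show "p_fun g ((1 - t) *\<^sub>R x + t *\<^sub>R z) \<le> (1 - t) * p_fun g x + t * p_fun g z"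
    using convex_onD[OF g, of t "x1 - x2" "z1 - z2"] t unfolding x_eq z_eq p_fun_def by simp
qed

text \<open>
  Membership of the starting point in the two sets is what lets the first step compare the new
  iterates with the old ones, as all later steps do.
\<close>
lemma ADMM_cf_balanced:
  fixes w y lam :: "nat \<Rightarrow> 'n::finite triple" and A :: "real ^ 'n ^ 'm::finite"
  assumes g: "continuously_differentiable g" "convex_on UNIV g"
    and admm: "ADMM_cf M d \<gamma> g A b \<mu> \<alpha> \<rho> w y lam"
    and \<rho>: "\<rho> = 1 / (2 * \<alpha>)" and \<mu>: "\<mu> > 2 / \<alpha>"
    and start: "w 0 \<in> Z1" "y 0 \<in> Z2 A b"
  shows "balanced_proximal_admm (h_fun M d \<gamma>) (p_fun g) Z1 (Z2 A b) \<alpha> \<rho> \<mu> w y lam"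
proof -
  have \<alpha>: "\<alpha> > 0" using admm by (simp add: ADMM_cf_def)
  have half: "1 - \<rho> * \<alpha> = 1 / 2" using \<alpha> \<rho> by simp
  have w_arg: "is_arg_min (\<lambda>u. aug_lagrangian (h_fun M d \<gamma>) (p_fun g) \<rho> \<alpha> u (y k) (lam k)
        + \<mu> / 2 * (norm (u - w k))\<^sup>2) (\<lambda>u. u \<in> Z1) (w (Suc k))"
    and y_arg: "is_arg_min (\<lambda>v. aug_lagrangian (h_fun M d \<gamma>) (p_fun g) \<rho> \<alpha> (w (Suc k)) v (lam k))
        (\<lambda>v. v \<in> Z2 A b) (y (Suc k))"
    and lam_eq: "lam (Suc k) = (1 - \<rho> * \<alpha>) *\<^sub>R lam k + \<rho> *\<^sub>R (w (Suc k) - y (Suc k))" for k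
    using admm by (simp_all add: ADMM_cf_def)
  show ?thesis
  proof
    show "w k \<in> Z1" for k using start w_arg by (cases k) (auto simp: is_arg_min_def)
    show "y k \<in> Z2 A b" for k using start y_arg by (cases k) (auto simp: is_arg_min_def)
    fix k
    show "lam (Suc k) = (1 / 2) *\<^sub>R lam k + \<rho> *\<^sub>R (w (Suc k) - y (Suc k))"
      using lam_eq unfolding half .
    show "h_fun M d \<gamma> (w (Suc k)) + (1 / 2) * (lam k \<bullet> w (Suc k))
          + \<rho> / 2 * (norm (w (Suc k) - y k))\<^sup>2 + \<mu> / 2 * (norm (w (Suc k) - w k))\<^sup>2
        \<le> h_fun M d \<gamma> u + (1 / 2) * (lam k \<bullet> u) + \<rho> / 2 * (norm (u - y k))\<^sup>2
          + \<mu> / 2 * (norm (u - w k))\<^sup>2" if u: "u \<in> Z1" for u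
    proof -
      have "aug_lagrangian (h_fun M d \<gamma>) (p_fun g) \<rho> \<alpha> (w (Suc k)) (y k) (lam k)
          + \<mu> / 2 * (norm (w (Suc k) - w k))\<^sup>2
        \<le> aug_lagrangian (h_fun M d \<gamma>) (p_fun g) \<rho> \<alpha> u (y k) (lam k)
          + \<mu> / 2 * (norm (u - w k))\<^sup>2"
        using w_arg[of k] u unfolding is_arg_min_def by (meson not_less)
      then show ?thesis
        unfolding aug_lagrangian_def half inner_diff_right by argo
    qed
    show "p_fun g (y (Suc k)) - (1 / 2) * (lam k \<bullet> y (Suc k))
          + \<rho> / 2 * (norm (w (Suc k) - y (Suc k)))\<^sup>2
        \<le> p_fun g v - (1 / 2) * (lam k \<bullet> v) + \<rho> / 2 * (norm (w (Suc k) - v))\<^sup>2"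
      if v: "v \<in> Z2 A b" for v
    proof -
      have "aug_lagrangian (h_fun M d \<gamma>) (p_fun g) \<rho> \<alpha> (w (Suc k)) (y (Suc k)) (lam k)
        \<le> aug_lagrangian (h_fun M d \<gamma>) (p_fun g) \<rho> \<alpha> (w (Suc k)) v (lam k)"
        using y_arg[of k] v unfolding is_arg_min_def by (meson not_less)
      then show ?thesis
        unfolding aug_lagrangian_def half inner_diff_right by argo
    qed
  qed (use \<alpha> \<rho> \<mu> g in \<open>auto intro: continuous_on_h_fun continuous_on_p_fun closed_Z1 closed_Z2
        convex_on_p_fun convex_Z2\<close>)
qed

theorem corollary1:
  fixes A :: "real ^ 'n ^ 'm" and b :: "real ^ 'm" and \<gamma> :: real
    and M :: "real ^ 'n ^ 'n" and d :: "real ^ 'n" and g :: "real ^ 'n \<Rightarrow> real"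
    and \<mu> \<alpha> \<rho> \<rho>m l \<epsilon> :: real
    and w y lam :: "nat \<Rightarrow> 'n triple"
  assumes "\<gamma> > 0" and "transpose M = M"
    and "continuously_differentiable g" and "convex_on UNIV g"
    and "ADMM_cf M d \<gamma> g A b \<mu> \<alpha> \<rho> w y lam"
    and "bounded (range w)" and "bounded (range y)"
    and "\<rho>m > 0"
    and "\<And>u v. u \<in> Z1 \<Longrightarrow> v \<in> Z2 A b \<Longrightarrow>
           h_fun M d \<gamma> u + p_fun g v + \<rho>m / 2 * (norm (u - v))\<^sup>2 \<ge> l"
    and "\<epsilon> > 0" and "\<epsilon> \<le> 1 / (4 * \<rho>m + 2)"
    and "\<alpha> = \<epsilon>" and "\<rho> = 1 / (2 * \<epsilon>)" and "\<mu> > 2 / \<epsilon>" and "w 0 = y 0"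
    and "w 0 \<in> Z1" and "y 0 \<in> Z2 A b"
  shows "\<exists>r ws ys lams. strict_mono r \<and> (\<forall>i. r i \<ge> (1::nat)) \<and>
     (\<lambda>i. (w (r i), y (r i), lam (r i))) \<longlonglongrightarrow> (ws, ys, lams) \<and>
     0 \<in> (\<lambda>v. v + lams) `
           limiting_subdifferential (\<lambda>u. ereal (h_fun M d \<gamma> u) + indicator_fun Z1 u) ws \<and>
     0 \<in> (\<lambda>v. v - lams) `
           limiting_subdifferential (\<lambda>v. ereal (p_fun g v) + indicator_fun (Z2 A b) v) ys \<and>
     (norm (ws - ys))\<^sup>2 \<le> \<alpha>\<^sup>2 * (norm lams)\<^sup>2 \<and>
     \<alpha>\<^sup>2 * (norm lams)\<^sup>2 \<le>
       (64 * (h_fun M d \<gamma> (w 0) + p_fun g (y 0)) - 64 * l + (14 + 5 * \<epsilon>) * (norm (lam 0))\<^sup>2) * \<epsilon>"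
proof -
  interpret balanced_proximal_admm "h_fun M d \<gamma>" "p_fun g" Z1 "Z2 A b" \<alpha> \<rho> \<mu> w y lam
    using assms by (intro ADMM_cf_balanced) auto
  obtain s ws ys lams where s: "strict_mono s"
    and w1: "(\<lambda>i. w (Suc (s i))) \<longlonglongrightarrow> ws" and y1: "(\<lambda>i. y (Suc (s i))) \<longlonglongrightarrow> ys"
    and lam1: "(\<lambda>i. lam (Suc (s i))) \<longlonglongrightarrow> lams"
    and w0: "(\<lambda>i. w (s i)) \<longlonglongrightarrow> ws" and y0: "(\<lambda>i. y (s i)) \<longlonglongrightarrow> ys"
    and lam0: "(\<lambda>i. lam (s i)) \<longlonglongrightarrow> lams"
    using convergent_subsequence[OF \<open>bounded (range w)\<close> \<open>bounded (range y)\<close>] by blast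
  note stationary = cluster_point_stationary[OF w1 y1 lam1 w0 y0 lam0]
  have "2 * \<rho>m + 1 \<le> 1 / (2 * \<epsilon>)"
    using \<open>\<epsilon> > 0\<close> \<open>\<rho>m > 0\<close> \<open>\<epsilon> \<le> 1 / (4 * \<rho>m + 2)\<close> by (simp add: field_simps)
  then have \<rho>m: "2 * \<rho>m \<le> \<rho>" using \<open>\<rho> = 1 / (2 * \<epsilon>)\<close> by linarith
  have \<epsilon>_half: "\<epsilon> \<le> 1 / 2"
  proof -
    have "1 / (4 * \<rho>m + 2) \<le> 1 / 2" using \<open>\<rho>m > 0\<close> by (simp add: field_simps)
    then show ?thesis using \<open>\<epsilon> \<le> 1 / (4 * \<rho>m + 2)\<close> by linarith
  qed
  define H where "H = h_fun M d \<gamma> (w 0) + p_fun g (y 0) - l"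
  have H: "0 \<le> H"
    using assms(9)[OF \<open>w 0 \<in> Z1\<close> \<open>y 0 \<in> Z2 A b\<close>] \<open>w 0 = y 0\<close> by (simp add: H_def)
  have "\<alpha> * (norm lams)\<^sup>2 \<le> 14 * H + 17 / 2 * \<alpha> * (norm (lam 0))\<^sup>2"
    unfolding H_def
    by (rule limit_multiplier_bound[OF \<open>w 0 = y 0\<close> assms(9) \<rho>m
          merit_limit_le[OF w1 y1 lam1 lam0 stationary(1)] stationary(1-3)])
  \<comment> \<open>The starting point is feasible with zero residual, so \<open>H \<ge> 0\<close> and enlarging its coefficient is
    harmless.\<close>
  also have "\<dots> \<le> 64 * H + (14 + 5 * \<epsilon>) * (norm (lam 0))\<^sup>2"
  proof (rule add_mono)
    have "17 / 2 * \<alpha> \<le> 14 + 5 * \<epsilon>"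
      using \<epsilon>_half \<open>\<alpha> = \<epsilon>\<close> \<open>\<epsilon> > 0\<close> by linarith
    then show "17 / 2 * \<alpha> * (norm (lam 0))\<^sup>2 \<le> (14 + 5 * \<epsilon>) * (norm (lam 0))\<^sup>2"
      by (rule mult_right_mono) simp
  qed (use H in simp)
  finally have "\<alpha> * (norm lams)\<^sup>2 * \<epsilon> \<le> (64 * H + (14 + 5 * \<epsilon>) * (norm (lam 0))\<^sup>2) * \<epsilon>"
    using \<open>\<epsilon> > 0\<close> by (intro mult_right_mono) auto
  then have bound: "\<alpha>\<^sup>2 * (norm lams)\<^sup>2 \<le> (64 * (h_fun M d \<gamma> (w 0) + p_fun g (y 0)) - 64 * l
      + (14 + 5 * \<epsilon>) * (norm (lam 0))\<^sup>2) * \<epsilon>"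
    using \<open>\<alpha> = \<epsilon>\<close> by (simp add: H_def power2_eq_square algebra_simps)
  show ?thesis
  proof (intro exI conjI)
    show "strict_mono (\<lambda>i. Suc (s i))" using s by (simp add: strict_mono_def)
    show "(\<lambda>i. (w (Suc (s i)), y (Suc (s i)), lam (Suc (s i)))) \<longlonglongrightarrow> (ws, ys, lams)"
      by (intro tendsto_Pair w1 y1 lam1)
    show "0 \<in> (\<lambda>v. v + lams) `
        limiting_subdifferential (\<lambda>u. ereal (h_fun M d \<gamma> u) + indicator_fun Z1 u) ws"
      using stationary(4) by (intro image_eqI[where x = "- lams"]) simp_all
    show "0 \<in> (\<lambda>v. v - lams) `
        limiting_subdifferential (\<lambda>v. ereal (p_fun g v) + indicator_fun (Z2 A b) v) ys"
      using stationary(5) by (intro image_eqI[where x = lams]) simp_all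
    show "(norm (ws - ys))\<^sup>2 \<le> \<alpha>\<^sup>2 * (norm lams)\<^sup>2"
      unfolding stationary(1) by (simp add: power_mult_distrib)
  qed (use bound in auto)
qed

end
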